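(* Let $n\geq 2$ and $k\in\mathbb{N}$. Then the map $\tau:T\mapsto T\cap\mathbf{D}_n$ defines a bijection between the maximal nilpotent subsemigroups of nilpotency class $k$ in $\mathbf{Q}_n$ and the maximal nilpotent subsemigroups of nilpotency class $k$ in $\mathbf{D}_n$. In particular, every nilpotent subsemigroup of $\mathbf{D}_n$ is contained in some maximal nilpotent subsemigroup of $\mathbf{D}_n$, and every maximal nilpotent subsemigroup of $\mathbf{D}_n$ has nilpotency class $n-1$.
   Context: $\mathbf{Q}_n=\{(a_{i,j})\in M_n(\mathbb{R}):\sum_{k=1}^n a_{k,i}=\sum_{k=1}^n a_{i,k}=1\text{ for all }i\}$, the semigroup (under matrix multiplication) of real $n\times n$ matrices all of whose row sums and column sums equal $1$. $\mathbf{D}_n\subset\mathbf{Q}_n$ is the semigroup of doubly stochastic matrices, i.e. the matrices in $\mathbf{Q}_n$ with all entries non-negative. The zero element of both semigroups is the matrix $\mathbb{O}_n$ all of whose entries equal $1/n$. $\mathbb{N}=\{1,2,3,\dots\}$. Let $S$ be a semigroup with zero element $0$. A (non-empty) subsemigroup $T\subset S$ is nilpotent if there is $k\in\mathbb{N}$ with $T^k=\{0\}$ (every product of $k$ elements of $T$ equals $0$); the minimal such $k$ is the nilpotency class of $T$. $\mathrm{Nil}_m(S)$ denotes the set of all nilpotent subsemigroups of $S$ of nilpotency class at most $m$, and $\mathrm{Nil}(S)=\bigcup_{m\in\mathbb{N}}\mathrm{Nil}_m(S)$. The maximal elements of $\mathrm{Nil}_m(S)$ with respect to inclusion are called maximal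 nilpotent subsemigroups of nilpotency class $m$ of $S$. The maximal elements of $\mathrm{Nil}(S)$ with respect to inclusion are called maximal nilpotent subsemigroups of $S$. *)

theory Defs
  imports "HOL-Analysis.Analysis"
begin

text \<open>Nilpotency in a semigroup with zero, given by its carrier \<open>S\<close>, its multiplication
  \<open>f\<close> and its zero element \<open>z\<close>.\<close>

definition subsemigroup :: "('a \<Rightarrow> 'a \<Rightarrow> 'a) \<Rightarrow> 'a set \<Rightarrow> 'a set \<Rightarrow> bool" where
  "subsemigroup f S T \<longleftrightarrow> T \<noteq> {} \<and> T \<subseteq> S \<and> (\<forall>a\<in>T. \<forall>b\<in>T. f a b \<in> T)"

text \<open>\<open>set_power f T k\<close> is the set of all products of \<open>k\<close> elements of \<open>T\<close>. Only exponents
  \<open>k \<ge> 1\<close> are meaningful; the value at \<open>0\<close> is a dummy.\<close>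

fun set_power :: "('a \<Rightarrow> 'a \<Rightarrow> 'a) \<Rightarrow> 'a set \<Rightarrow> nat \<Rightarrow> 'a set" where
  "set_power f T 0 = {}"
| "set_power f T (Suc 0) = T"
| "set_power f T (Suc (Suc k)) = {f a b |a b. a \<in> set_power f T (Suc k) \<and> b \<in> T}"

definition nilpotent_set :: "('a \<Rightarrow> 'a \<Rightarrow> 'a) \<Rightarrow> 'a \<Rightarrow> 'a set \<Rightarrow> bool" where
  "nilpotent_set f z T \<longleftrightarrow> (\<exists>k\<ge>1. set_power f T k = {z})"

definition nilpotency_class :: "('a \<Rightarrow> 'a \<Rightarrow> 'a) \<Rightarrow> 'a \<Rightarrow> 'a set \<Rightarrow> nat" where
  "nilpotency_class f z T = (LEAST k. k \<ge> 1 \<and> set_power f T k = {z})"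

definition Nil_upto :: "('a \<Rightarrow> 'a \<Rightarrow> 'a) \<Rightarrow> 'a \<Rightarrow> 'a set \<Rightarrow> nat \<Rightarrow> 'a set set" where
  "Nil_upto f z S m =
    {T. subsemigroup f S T \<and> nilpotent_set f z T \<and> nilpotency_class f z T \<le> m}"

definition Nil_all :: "('a \<Rightarrow> 'a \<Rightarrow> 'a) \<Rightarrow> 'a \<Rightarrow> 'a set \<Rightarrow> 'a set set" where
  "Nil_all f z S = (\<Union>m\<in>{1..}. Nil_upto f z S m)"

definition maximal_members :: "'a set set \<Rightarrow> 'a set set" where
  "maximal_members F = {T \<in> F. \<forall>U\<in>F. T \<subseteq> U \<longrightarrow> U = T}"

text \<open>``Maximal nilpotent of class \<open>m\<close>'' means maximal among the nilpotent subsemigroups of class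
  at most \<open>m\<close>; the class of such a subsemigroup may be smaller than \<open>m\<close>.\<close>

definition max_nilpotent_of_class ::
    "('a \<Rightarrow> 'a \<Rightarrow> 'a) \<Rightarrow> 'a \<Rightarrow> 'a set \<Rightarrow> nat \<Rightarrow> 'a set set" where
  "max_nilpotent_of_class f z S m = maximal_members (Nil_upto f z S m)"

definition max_nilpotent :: "('a \<Rightarrow> 'a \<Rightarrow> 'a) \<Rightarrow> 'a \<Rightarrow> 'a set \<Rightarrow> 'a set set" where
  "max_nilpotent f z S = maximal_members (Nil_all f z S)"

definition Q_mat :: "(real^'n^'n) set" where
  "Q_mat = {A. \<forall>i. (\<Sum>k\<in>UNIV. A $ k $ i) = 1 \<and> (\<Sum>k\<in>UNIV. A $ i $ k) = 1}"

definition D_mat :: "(real^'n^'n) set" where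
  "D_mat = {A \<in> Q_mat. \<forall>i j. A $ i $ j \<ge> 0}"

definition O_mat :: "real^'n^'n" where
  "O_mat = (\<chi> i j. 1 / real CARD('n))"

text \<open>The multiplication on both sets is the matrix product \<open>(**)\<close> (not the entrywise product
  \<open>(*)\<close>). Both are closed under it, and \<open>O_mat\<close> is their zero element.\<close>

lemma Q_mat_mult_closed:
  assumes "A \<in> Q_mat" "B \<in> Q_mat" shows "A ** B \<in> Q_mat"
proof -
  have "(\<Sum>k\<in>UNIV. (A ** B) $ k $ i) = 1" for i
  proof -
    have "(\<Sum>k\<in>UNIV. (A ** B) $ k $ i) = (\<Sum>l\<in>UNIV. \<Sum>k\<in>UNIV. A $ k $ l * B $ l $ i)"
      unfolding matrix_matrix_mult_def by (simp, rule sum.swap)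
    also have "\<dots> = 1"
      using assms by (simp add: Q_mat_def sum_distrib_right[symmetric])
    finally show ?thesis .
  qed
  moreover have "(\<Sum>k\<in>UNIV. (A ** B) $ i $ k) = 1" for i
  proof -
    have "(\<Sum>k\<in>UNIV. (A ** B) $ i $ k) = (\<Sum>l\<in>UNIV. \<Sum>k\<in>UNIV. A $ i $ l * B $ l $ k)"
      unfolding matrix_matrix_mult_def by (simp, rule sum.swap)
    also have "\<dots> = 1"
      using assms by (simp add: Q_mat_def sum_distrib_left[symmetric])
    finally show ?thesis .
  qed
  ultimately show ?thesis by (simp add: Q_mat_def)
qed

lemma D_mat_mult_closed:
  assumes "A \<in> D_mat" "B \<in> D_mat" shows "A ** B \<in> D_mat"
  using assms Q_mat_mult_closed[of A B]
  by (auto simp: D_mat_def matrix_matrix_mult_def intro!: sum_nonneg)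

lemma O_mat_in_D_mat: "O_mat \<in> D_mat"
  by (simp add: O_mat_def D_mat_def Q_mat_def)

lemma O_mat_zero:
  assumes "A \<in> Q_mat" shows "A ** O_mat = O_mat" "O_mat ** A = O_mat"
  using assms
  by (simp_all add: Q_mat_def O_mat_def matrix_matrix_mult_def vec_eq_iff
      sum_divide_distrib[symmetric])

end

theory Submission
  imports Defs
begin

text \<open>Subtracting \<open>O_mat\<close> identifies \<open>Q_mat\<close> with the algebra of matrices whose row and column sums
  vanish, that is, with the endomorphisms of the hyperplane of vectors of coordinate sum \<open>0\<close>. There
  the span of a nilpotent set is nilpotent of the same class, so maximal elements are subspaces. Since
  \<open>D_mat\<close> is a neighbourhood of \<open>O_mat\<close> in \<open>Q_mat\<close>, every subspace through \<open>O_mat\<close> is recovered from its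
  intersection with \<open>D_mat\<close>; this gives the bijection. For the class, a nilpotent set of operators is
  strictly triangular with respect to a suitable basis of the hyperplane; the maximal ones therefore
  contain every small strictly triangular operator, in particular a multiple of the shift along that
  basis, which has class exactly \<open>n - 1\<close>.\<close>

section \<open>Powers and nilpotent subsemigroups\<close>

lemma set_power_Suc:
  "k \<ge> 1 \<Longrightarrow> set_power f T (Suc k) = {f a b |a b. a \<in> set_power f T k \<and> b \<in> T}"
  by (cases k) auto

text \<open>Powers have only a dummy value at exponent 0, so inductions on the exponent start at
  1.\<close>

lemma nat_induct_from_1 [consumes 1, case_names one Suc]:
  fixes k :: nat
  assumes "k \<ge> 1" "P 1" "\<And>k. k \<ge> 1 \<Longrightarrow> P k \<Longrightarrow> P (Suc k)"
  shows "P k"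
  using assms by (rule dec_induct) auto

lemma set_power_mono: "T \<subseteq> U \<Longrightarrow> set_power f T k \<subseteq> set_power f U k"
proof (induction k rule: induct_nat_012)
  case (ge2 k)
  then show ?case by simp blast
qed auto

lemma set_power_nonempty: "k \<ge> 1 \<Longrightarrow> T \<noteq> {} \<Longrightarrow> set_power f T k \<noteq> {}"
proof (induction k rule: nat_induct_from_1)
  case (Suc k)
  then show ?case by (simp add: set_power_Suc) blast
qed simp

lemma set_power_eq_singletonI:
  "k \<ge> 1 \<Longrightarrow> T \<noteq> {} \<Longrightarrow> set_power f T k \<subseteq> {z} \<Longrightarrow> set_power f T k = {z}"
  using set_power_nonempty[of k T f] by blast

lemma set_power_subset:
  assumes "\<forall>a\<in>T. \<forall>b\<in>T. f a b \<in> T"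
  shows "set_power f T k \<subseteq> T"
proof (induction k rule: induct_nat_012)
  case (ge2 k)
  then show ?case using assms by auto
qed auto

text \<open>Closure of \<open>S\<close> keeps every partial product inside \<open>S\<close>, the
  only place where \<open>h\<close> is known to be multiplicative. It serves to translate by
  \<open>O_mat\<close>.\<close>

lemma set_power_image:
  assumes hom: "\<forall>a\<in>S. \<forall>b\<in>S. h (f a b) = g (h a) (h b)"
    and closed: "\<forall>a\<in>S. \<forall>b\<in>S. f a b \<in> S" and "T \<subseteq> S"
  shows "set_power g (h ` T) k = h ` set_power f T k"
proof (induction k rule: induct_nat_012)
  case (ge2 k)
  have "set_power f T (Suc k) \<subseteq> S"
    using set_power_mono[OF \<open>T \<subseteq> S\<close>, of f "Suc k"] set_power_subset[OF closed, of "Suc k"] by blast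
  then have *: "h (f a b) = g (h a) (h b)" if "a \<in> set_power f T (Suc k)" "b \<in> T" for a b
    using that hom \<open>T \<subseteq> S\<close> by blast
  show ?case
    unfolding set_power.simps(3) ge2.IH
    by (auto simp: image_iff) (metis *)+
qed auto

lemma zero_mem_subsemigroup:
  assumes "subsemigroup f S T" "set_power f T k = {z}"
  shows "z \<in> T"
  using assms set_power_subset[of T f k] unfolding subsemigroup_def by auto

text \<open>Once a power equals \<open>{z}\<close>, absorption keeps all later powers equal to
  \<open>{z}\<close>; so the least exponent can be traded for the single equation at
  \<open>m\<close>.\<close>

lemma Nil_upto_iff:
  assumes zero: "\<forall>a\<in>S. f z a = z" and "m \<ge> 1"
  shows "T \<in> Nil_upto f z S m \<longleftrightarrow> subsemigroup f S T \<and> set_power f T m = {z}"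
proof
  assume T: "T \<in> Nil_upto f z S m"
  define c where "c = nilpotency_class f z T"
  from T have sub: "subsemigroup f S T" and "\<exists>k. k \<ge> 1 \<and> set_power f T k = {z}" and "c \<le> m"
    by (auto simp: Nil_upto_def nilpotent_set_def c_def)
  from LeastI_ex[OF this(2)] have c: "c \<ge> 1" "set_power f T c = {z}"
    by (auto simp: c_def nilpotency_class_def)
  from \<open>c \<le> m\<close> have "set_power f T m = {z}"
  proof (induction rule: dec_induct)
    case (step k)
    then have "set_power f T (Suc k) = {f a b |a b. a \<in> {z} \<and> b \<in> T}"
      using c by (subst set_power_Suc) auto
    also have "\<dots> = {z}"
      using sub zero unfolding subsemigroup_def by auto (metis subsetD)
    finally show ?case .
  qed (use c in auto)
  with sub show "subsemigroup f S T \<and> set_power f T m = {z}" by blast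
next
  assume T: "subsemigroup f S T \<and> set_power f T m = {z}"
  with \<open>m \<ge> 1\<close> have "nilpotency_class f z T \<le> m"
    unfolding nilpotency_class_def by (intro Least_le) auto
  with T \<open>m \<ge> 1\<close> show "T \<in> Nil_upto f z S m"
    by (auto simp: Nil_upto_def nilpotent_set_def)
qed

lemma nilpotency_class_power:
  assumes "nilpotent_set f z T"
  shows "nilpotency_class f z T \<ge> 1" "set_power f T (nilpotency_class f z T) = {z}"
proof -
  from assms have "\<exists>k. k \<ge> 1 \<and> set_power f T k = {z}"
    by (auto simp: nilpotent_set_def)
  from LeastI_ex[OF this] show "nilpotency_class f z T \<ge> 1"
    "set_power f T (nilpotency_class f z T) = {z}"
    by (auto simp: nilpotency_class_def)
qed

text \<open>A product of \<open>k\<close> factors involves finitely many members of the chain, and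
  the largest of these contains all the factors.\<close>

lemma set_power_Union_chain:
  assumes "subset.chain A C" "x \<in> set_power f (\<Union>C) k" "k \<ge> 1"
  shows "\<exists>X\<in>C. x \<in> set_power f X k"
  using assms(3,2)
proof (induction k arbitrary: x rule: nat_induct_from_1)
  case (Suc k)
  then obtain a b where x: "x = f a b" "a \<in> set_power f (\<Union>C) k" "b \<in> \<Union>C"
    by (auto simp: set_power_Suc)
  with Suc obtain X Y where XY: "X \<in> C" "a \<in> set_power f X k" "Y \<in> C" "b \<in> Y"
    by blast
  with assms(1) have "X \<subseteq> Y \<or> Y \<subseteq> X"
    by (auto simp: subset_chain_def)
  then obtain Z where "Z \<in> C" "X \<subseteq> Z" "Y \<subseteq> Z"
    using XY by blast
  with XY have "a \<in> set_power f Z k" "b \<in> Z"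
    using set_power_mono[of X Z f k] by auto
  then show ?case
    using \<open>Z \<in> C\<close> x Suc.hyps by (auto simp: set_power_Suc)
qed auto

text \<open>Zorn's lemma. The fixed bound \<open>m\<close> makes the union of a chain nilpotent
  again; along a chain of unbounded classes this may fail.\<close>

lemma Nil_upto_extends_to_maximal:
  assumes zero: "\<forall>a\<in>S. f z a = z" and "m \<ge> 1" and T: "T \<in> Nil_upto f z S m"
  shows "\<exists>M\<in>maximal_members (Nil_upto f z S m). T \<subseteq> M"
proof -
  note iff = Nil_upto_iff[where f = f and z = z, OF zero \<open>m \<ge> 1\<close>]
  define A where "A = {U \<in> Nil_upto f z S m. T \<subseteq> U}"
  have "\<exists>M\<in>A. \<forall>X\<in>A. M \<subseteq> X \<longrightarrow> X = M"
  proof (rule subset_Zorn_nonempty)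
    show "A \<noteq> {}" using T by (auto simp: A_def)
  next
    fix C assume C: "C \<noteq> {}" "subset.chain A C"
    then have mem: "subsemigroup f S X" "set_power f X m = {z}" "T \<subseteq> X" if "X \<in> C" for X
      using that by (auto simp: A_def subset_chain_def iff)
    have "\<Union>C \<subseteq> S"
      using mem(1) by (auto simp: subsemigroup_def)
    moreover have "T \<subseteq> \<Union>C"
      using C(1) mem(3) by blast
    moreover have "T \<noteq> {}"
      using T by (simp add: iff subsemigroup_def)
    with \<open>T \<subseteq> \<Union>C\<close> have "\<Union>C \<noteq> {}" by blast
    moreover have "f a b \<in> \<Union>C" if ab: "a \<in> \<Union>C" "b \<in> \<Union>C" for a b
    proof -
      from ab obtain X Y where XY: "X \<in> C" "a \<in> X" "Y \<in> C" "b \<in> Y" by blast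
      with C(2) have "X \<subseteq> Y \<or> Y \<subseteq> X" by (auto simp: subset_chain_def)
      with XY mem(1) show ?thesis unfolding subsemigroup_def by blast
    qed
    moreover have "set_power f (\<Union>C) m \<subseteq> {z}"
      using set_power_Union_chain[OF C(2) _ \<open>m \<ge> 1\<close>, of _ f] mem(2) by fastforce
    with \<open>m \<ge> 1\<close> \<open>\<Union>C \<noteq> {}\<close> have "set_power f (\<Union>C) m = {z}"
      by (rule set_power_eq_singletonI)
    ultimately show "\<Union>C \<in> A"
      by (simp add: A_def iff subsemigroup_def)
  qed
  then obtain M where M: "M \<in> A" "\<forall>X\<in>A. M \<subseteq> X \<longrightarrow> X = M" by blast
  then have "M \<in> maximal_members (Nil_upto f z S m)"
    by (auto simp: A_def maximal_members_def)
  with M show ?thesis by (auto simp: A_def)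
qed

section \<open>Matrices with vanishing row and column sums\<close>

definition zero_sum_vec :: "(real^'n) set" where
  "zero_sum_vec = {v. (\<Sum>i\<in>UNIV. v $ i) = 0}"

text \<open>Phrased through the action on vectors, so that closure under products and invariance of
  the hyperplane are immediate; the entrywise form is \<open>zero_sum_mat_iff\<close>.\<close>

definition zero_sum_mat :: "(real^'n^'n) set" where
  "zero_sum_mat = {X. X *v 1 = 0 \<and> (\<forall>v. X *v v \<in> zero_sum_vec)}"

lemma subspace_zero_sum_vec: "subspace zero_sum_vec"
  by (auto simp: subspace_def zero_sum_vec_def sum.distrib sum_distrib_left[symmetric])

lemma dim_zero_sum_vec: "dim (zero_sum_vec :: (real^'n) set) = CARD('n) - 1"
proof -
  have "zero_sum_vec = {v :: real^'n. 1 \<bullet> v = 0}"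
    by (auto simp: zero_sum_vec_def inner_vec_def)
  moreover have "(1 :: real^'n) \<noteq> 0" by (simp add: vec_eq_iff)
  ultimately show ?thesis
    using dim_hyperplane[of "1 :: real^'n"] by simp
qed

lemma subspace_zero_sum_mat: "subspace zero_sum_mat"
  using subspace_zero_sum_vec
  by (auto simp: subspace_def zero_sum_mat_def algebra_simps scaleR_matrix_vector_assoc[symmetric])

lemma zero_sum_mat_mult: "X \<in> zero_sum_mat \<Longrightarrow> Y \<in> zero_sum_mat \<Longrightarrow> X ** Y \<in> zero_sum_mat"
  by (auto simp: zero_sum_mat_def matrix_vector_mul_assoc[symmetric])

lemma sum_matrix_vector_mult:
  fixes X :: "real^'n^'n"
  shows "(\<Sum>i\<in>UNIV. (X *v v) $ i) = (\<Sum>j\<in>UNIV. (\<Sum>i\<in>UNIV. X $ i $ j) * v $ j)"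
  by (simp add: matrix_vector_mult_def sum_distrib_right) (rule sum.swap)

lemma zero_sum_mat_iff:
  "X \<in> zero_sum_mat \<longleftrightarrow> (\<forall>i. (\<Sum>k\<in>UNIV. X $ k $ i) = 0 \<and> (\<Sum>k\<in>UNIV. X $ i $ k) = 0)"
proof -
  have "(\<Sum>k\<in>UNIV. X $ k $ i) = 0" if "\<forall>v. X *v v \<in> zero_sum_vec" for i
    using that[rule_format, of "axis i 1"]
    by (simp add: zero_sum_vec_def matrix_vector_mult_basis column_def)
  moreover have "X *v v \<in> zero_sum_vec" if "\<forall>i. (\<Sum>k\<in>UNIV. X $ k $ i) = 0" for v
    using that by (simp add: zero_sum_vec_def sum_matrix_vector_mult)
  moreover have "X *v 1 = 0 \<longleftrightarrow> (\<forall>i. (\<Sum>k\<in>UNIV. X $ i $ k) = 0)"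
    by (simp add: vec_eq_iff matrix_vector_mult_def)
  ultimately show ?thesis by (auto simp: zero_sum_mat_def)
qed

lemma Q_mat_iff_zero_sum: "A \<in> Q_mat \<longleftrightarrow> A - O_mat \<in> zero_sum_mat"
  by (simp add: Q_mat_def zero_sum_mat_iff O_mat_def sum_subtractf)

lemma O_mat_in_Q_mat: "O_mat \<in> Q_mat"
  using O_mat_in_D_mat by (auto simp: D_mat_def)

lemma D_mat_subset_Q_mat: "D_mat \<subseteq> Q_mat"
  by (auto simp: D_mat_def)

text \<open>\<open>O_mat\<close> is the orthogonal projection onto the line of constant vectors,
  hence \<open>v - O_mat *v v\<close> is the component of \<open>v\<close> in the
  hyperplane.\<close>

lemma O_mat_mult_vec: "O_mat *v v = ((\<Sum>i\<in>UNIV. v $ i) / real CARD('n)) *\<^sub>R (1 :: real^'n)"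
  by (simp add: vec_eq_iff O_mat_def matrix_vector_mult_def sum_divide_distrib)

lemma diff_O_mat_mult_vec: "v - O_mat *v v \<in> zero_sum_vec"
  by (simp add: zero_sum_vec_def O_mat_mult_vec sum_subtractf)

lemma zero_sum_mat_O_mat: "X \<in> zero_sum_mat \<Longrightarrow> X *v (O_mat *v v) = 0"
  by (simp add: O_mat_mult_vec zero_sum_mat_def matrix_vector_mult_scaleR)

text \<open>Each vector is a hyperplane vector plus a constant one, and \<open>X\<close> kills the
  constants; so \<open>X\<close> is determined by its restriction to the hyperplane.\<close>

lemma zero_sum_mat_eqI:
  assumes "X \<in> zero_sum_mat" "\<And>v. v \<in> zero_sum_vec \<Longrightarrow> X *v v = 0"
  shows "X = 0"
proof -
  have "X *v v = 0" for v
    using assms(2)[OF diff_O_mat_mult_vec, of v] zero_sum_mat_O_mat[OF assms(1), of v]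
    by (simp add: algebra_simps)
  then show ?thesis by (simp add: matrix_eq)
qed

section \<open>Products and linear spans of matrices\<close>

lemma bilinear_matrix_mult: "bilinear ((**) :: real^'n^'n \<Rightarrow> _)"
  by (auto simp: bilinear_def linear_iff vec_eq_iff matrix_matrix_mult_def sum.distrib
      sum_distrib_left algebra_simps)

lemma span_matrix_mult:
  fixes A B :: "(real^'n^'n) set"
  assumes "X \<in> span A" "Y \<in> span B"
  shows "X ** Y \<in> span {a ** b |a b. a \<in> A \<and> b \<in> B}"
proof -
  let ?C = "span {a ** b |a b. a \<in> A \<and> b \<in> B}"
  \<comment> \<open>Bilinearity is used one factor at a time: first \<open>Y\<close> varies over the
    span with the left factor in \<open>A\<close>, then \<open>X\<close> does.\<close>
  have 1: "a ** Y \<in> ?C" if "a \<in> A" for a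
    using assms(2)
  proof (induction rule: span_induct)
    case base
    show ?case
      by (auto simp: subspace_def bilinear_radd[OF bilinear_matrix_mult]
          bilinear_rzero[OF bilinear_matrix_mult] bilinear_rmul[OF bilinear_matrix_mult]
          span_zero span_add span_scale)
  next
    case (step b)
    with that show ?case by (auto intro: span_base)
  qed
  show ?thesis
    using assms(1)
  proof (induction rule: span_induct)
    case base
    show ?case
      by (auto simp: subspace_def bilinear_ladd[OF bilinear_matrix_mult]
          bilinear_lzero[OF bilinear_matrix_mult] bilinear_lmul[OF bilinear_matrix_mult]
          span_zero span_add span_scale)
  qed (rule 1)
qed

text \<open>This is why passing to the linear span does not destroy nilpotency or raise the
  class.\<close>

lemma set_power_span:
  fixes T :: "(real^'n^'n) set"
  shows "k \<ge> 1 \<Longrightarrow> set_power (**) (span T) k \<subseteq> span (set_power (**) T k)"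
proof (induction k rule: nat_induct_from_1)
  case (Suc k)
  then show ?case
    using span_matrix_mult[of _ "set_power (**) T k" _ T] by (auto simp: set_power_Suc)
qed auto

text \<open>On expanding the right-hand side, the two mixed products and the square of
  \<open>O_mat\<close> are all \<open>O_mat\<close>, and together they contribute a single
  \<open>- O_mat\<close>.\<close>

lemma Q_mat_mult_diff_O_mat:
  assumes "A \<in> Q_mat" "B \<in> Q_mat"
  shows "A ** B - O_mat = (A - O_mat) ** (B - O_mat)"
  using assms
  by (simp add: O_mat_zero O_mat_in_Q_mat bilinear_lsub[OF bilinear_matrix_mult]
      bilinear_rsub[OF bilinear_matrix_mult])

abbreviation centre :: "(real^'n^'n) set \<Rightarrow> (real^'n^'n) set" where
  "centre T \<equiv> (\<lambda>A. A - O_mat) ` T"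

lemma set_power_centre:
  assumes "T \<subseteq> Q_mat"
  shows "set_power (**) (centre T) k = centre (set_power (**) T k)"
  by (rule set_power_image[OF _ _ assms]) (auto simp: Q_mat_mult_diff_O_mat Q_mat_mult_closed)

lemma set_power_O_mat_iff:
  assumes "T \<subseteq> Q_mat"
  shows "set_power (**) T k = {O_mat} \<longleftrightarrow> set_power (**) (centre T) k = {0}"
proof -
  have "inj (\<lambda>A. A - (O_mat :: real^'a^'a))" by (rule injI) simp
  from inj_image_eq_iff[OF this, of "set_power (**) T k" "{O_mat}"]
  show ?thesis by (simp add: set_power_centre[OF assms])
qed

lemma Nil_upto_mat_iff:
  assumes "S \<subseteq> Q_mat" "k \<ge> 1"
  shows "T \<in> Nil_upto (**) O_mat S k \<longleftrightarrow>
    subsemigroup (**) S T \<and> set_power (**) (centre T) k = {0}"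
proof (cases "subsemigroup (**) S T")
  case True
  then have "T \<subseteq> Q_mat" using assms by (auto simp: subsemigroup_def)
  with assms show ?thesis
    by (subst Nil_upto_iff) (auto simp: O_mat_zero set_power_O_mat_iff)
qed (auto simp: Nil_upto_def)

section \<open>Recovering a subalgebra from its doubly stochastic part\<close>

text \<open>All entries of \<open>O_mat\<close> are the positive number \<open>1/n\<close>, so a
  small enough perturbation keeps them nonnegative.\<close>

lemma D_mat_neighbourhood:
  assumes "X \<in> (zero_sum_mat :: (real^'n^'n) set)"
  shows "\<exists>e>0. O_mat + e *\<^sub>R X \<in> D_mat"
proof (intro exI conjI)
  \<comment> \<open>Chosen so that \<open>e\<close> times any entry of \<open>X\<close> is at most
    \<open>1/n\<close> in absolute value; the summand 1 avoids a division by zero when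
    \<open>X = 0\<close>.\<close>
  define e where "e = 1 / (real CARD('n) * (1 + norm X))"
  show "e > 0" by (simp add: e_def add_pos_nonneg)
  have "O_mat + e *\<^sub>R X \<in> Q_mat"
    using assms by (simp add: Q_mat_iff_zero_sum subspace_scale[OF subspace_zero_sum_mat])
  moreover have "(O_mat + e *\<^sub>R X) $ i $ j \<ge> 0" for i j
  proof -
    have "\<bar>X $ i $ j\<bar> \<le> norm X"
      using component_le_norm_cart[of "X $ i" j] Finite_Cartesian_Product.norm_nth_le[of X i]
      by linarith
    then have "e * (- (X $ i $ j)) \<le> e * (1 + norm X)"
      using \<open>e > 0\<close> by (intro mult_left_mono) auto
    also have "\<dots> = 1 / real CARD('n)"
      by (simp add: e_def add_nonneg_eq_0_iff)
    finally show ?thesis by (simp add: O_mat_def)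
  qed
  ultimately show "O_mat + e *\<^sub>R X \<in> D_mat" by (simp add: D_mat_def)
qed

text \<open>The smallest affine subspace containing both \<open>T\<close> and \<open>O_mat\<close>.
  It will be the inverse of intersecting with \<open>D_mat\<close>.\<close>

definition hull_Q :: "(real^'n^'n) set \<Rightarrow> (real^'n^'n) set" where
  "hull_Q T = {A. A - O_mat \<in> span (centre T)}"

lemma hull_Q_superset: "T \<subseteq> hull_Q T"
  by (auto simp: hull_Q_def intro: span_base)

lemma hull_Q_mono: "T \<subseteq> U \<Longrightarrow> hull_Q T \<subseteq> hull_Q U"
  unfolding hull_Q_def using span_mono[of "centre T" "centre U"] by auto

lemma centre_hull_Q: "centre (hull_Q T) = span (centre T)"
proof -
  have "X \<in> centre (hull_Q T)" if "X \<in> span (centre T)" for X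
    using that by (intro image_eqI[of _ _ "O_mat + X"]) (auto simp: hull_Q_def)
  then show ?thesis by (auto simp: hull_Q_def)
qed

text \<open>After centring, products of spanning elements stay in the spanning set, and the
  \<open>k\<close>-th power of the span lies in the span of the \<open>k\<close>-th power, which is
  0.\<close>

lemma hull_Q_Nil_upto:
  assumes T: "T \<in> Nil_upto (**) O_mat Q_mat k" and "k \<ge> 1"
  shows "hull_Q T \<in> Nil_upto (**) O_mat Q_mat k"
proof -
  note iff = Nil_upto_mat_iff[OF order_refl \<open>k \<ge> 1\<close>]
  from T have sub: "T \<noteq> {}" "T \<subseteq> Q_mat" "\<forall>a\<in>T. \<forall>b\<in>T. a ** b \<in> T"
    and pow: "set_power (**) (centre T) k = {0}"
    by (auto simp: iff subsemigroup_def)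
  have "centre T \<subseteq> zero_sum_mat"
    using sub by (auto simp: Q_mat_iff_zero_sum)
  then have "span (centre T) \<subseteq> zero_sum_mat"
    using span_minimal subspace_zero_sum_mat by blast
  then have Q: "hull_Q T \<subseteq> Q_mat"
    by (auto simp: hull_Q_def Q_mat_iff_zero_sum)
  have "{a ** b |a b. a \<in> centre T \<and> b \<in> centre T} \<subseteq> centre T"
    using sub by (auto simp: Q_mat_mult_diff_O_mat[symmetric] subset_iff)
  then have closed: "X ** Y \<in> span (centre T)" if "X \<in> span (centre T)" "Y \<in> span (centre T)" for X Y
    using span_matrix_mult[OF that] span_mono by blast
  have "a ** b \<in> hull_Q T" if "a \<in> hull_Q T" "b \<in> hull_Q T" for a b
    using closed[of "a - O_mat" "b - O_mat"] that Q
    by (auto simp: hull_Q_def Q_mat_mult_diff_O_mat subset_iff)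
  moreover have "set_power (**) (centre (hull_Q T)) k \<subseteq> {0}"
    using set_power_span[OF \<open>k \<ge> 1\<close>, of "centre T"] pow by (simp add: centre_hull_Q)
  then have "set_power (**) (centre (hull_Q T)) k = {0}"
    using \<open>k \<ge> 1\<close> sub(1) hull_Q_superset[of T] by (intro set_power_eq_singletonI) auto
  moreover have "hull_Q T \<noteq> {}"
    using sub(1) hull_Q_superset[of T] by blast
  ultimately show ?thesis
    using Q by (simp add: iff subsemigroup_def)
qed

lemma Nil_upto_D_mat_iff:
  "T \<in> Nil_upto (**) O_mat D_mat k \<longleftrightarrow> T \<in> Nil_upto (**) O_mat Q_mat k \<and> T \<subseteq> D_mat"
  using D_mat_subset_Q_mat by (auto simp: Nil_upto_def subsemigroup_def)

text \<open>The intersection is not empty because a nilpotent subsemigroup contains its zero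
  \<open>O_mat\<close>, which is doubly stochastic.\<close>

lemma Nil_upto_Int_D_mat:
  assumes T: "T \<in> Nil_upto (**) O_mat Q_mat k" and "k \<ge> 1"
  shows "T \<inter> D_mat \<in> Nil_upto (**) O_mat D_mat k"
proof -
  have zero: "\<forall>a\<in>Q_mat. O_mat ** a = (O_mat :: real^'a^'a)" by (simp add: O_mat_zero)
  note iff = Nil_upto_iff[where f = "(**)" and z = O_mat, OF zero \<open>k \<ge> 1\<close>]
  from T have sub: "subsemigroup (**) Q_mat T" and pow: "set_power (**) T k = {O_mat}"
    by (auto simp: iff)
  have "O_mat \<in> T \<inter> D_mat"
    using zero_mem_subsemigroup[OF sub pow] O_mat_in_D_mat by blast
  moreover from this have "set_power (**) (T \<inter> D_mat) k = {O_mat}"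
    using set_power_mono[of "T \<inter> D_mat" T "(**)" k] pow \<open>k \<ge> 1\<close>
    by (intro set_power_eq_singletonI) auto
  ultimately show ?thesis
    using sub unfolding Nil_upto_D_mat_iff iff
    by (auto simp: subsemigroup_def D_mat_mult_closed)
qed

lemma maximal_hull_Q:
  assumes T: "T \<in> maximal_members (Nil_upto (**) O_mat Q_mat k)" and "k \<ge> 1"
  shows "hull_Q T = T"
  using assms hull_Q_Nil_upto[of T k] hull_Q_superset[of T] by (auto simp: maximal_members_def)

lemma maximal_hull_Q_Int_D_mat:
  assumes T: "T \<in> maximal_members (Nil_upto (**) O_mat Q_mat k)" and "k \<ge> 1"
  shows "hull_Q (T \<inter> D_mat) = T"
proof
  note hull = maximal_hull_Q[OF assms]
  show "hull_Q (T \<inter> D_mat) \<subseteq> T"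
    using hull_Q_mono[of "T \<inter> D_mat" T] hull by auto
  show "T \<subseteq> hull_Q (T \<inter> D_mat)"
  proof
    fix A assume A: "A \<in> T"
    then have "A - O_mat \<in> zero_sum_mat"
      using T unfolding Q_mat_iff_zero_sum[symmetric]
      by (auto simp: maximal_members_def Nil_upto_def subsemigroup_def)
    \<comment> \<open>\<open>A\<close> is moved towards \<open>O_mat\<close> until it enters
      \<open>D_mat\<close>. The moved point remains in the affine subspace \<open>T\<close>, and
      scaling by \<open>inverse e\<close> recovers \<open>A\<close>.\<close>
    then obtain e where e: "e > 0" "O_mat + e *\<^sub>R (A - O_mat) \<in> D_mat"
      using D_mat_neighbourhood by blast
    have "O_mat + e *\<^sub>R (A - O_mat) \<in> hull_Q T"
      using A by (simp add: hull_Q_def span_scale span_base)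
    with e hull have "e *\<^sub>R (A - O_mat) \<in> centre (T \<inter> D_mat)"
      by (intro image_eqI[of _ _ "O_mat + e *\<^sub>R (A - O_mat)"]) simp_all
    from span_scale[OF span_base[OF this], of "inverse e"] e(1)
    show "A \<in> hull_Q (T \<inter> D_mat)" by (simp add: hull_Q_def)
  qed
qed

lemma bij_betw_Int_D_mat:
  fixes k :: nat
  assumes "k \<ge> 1"
  shows "bij_betw (\<lambda>T. T \<inter> D_mat)
    (max_nilpotent_of_class (**) O_mat (Q_mat :: (real^'n^'n) set) k)
    (max_nilpotent_of_class (**) O_mat (D_mat :: (real^'n^'n) set) k)"
  unfolding max_nilpotent_of_class_def
proof (rule bij_betwI[where g = hull_Q])
  let ?Q = "Nil_upto (**) O_mat (Q_mat :: (real^'n^'n) set) k"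
  let ?D = "Nil_upto (**) O_mat (D_mat :: (real^'n^'n) set) k"
  have maxD: "T \<inter> D_mat \<in> maximal_members ?D" if T: "T \<in> maximal_members ?Q" for T
  proof -
    \<comment> \<open>The hull of a larger \<open>U\<close> contains the hull of
      \<open>T \<inter> D_mat\<close>, which is \<open>T\<close>; maximality of \<open>T\<close>
      then forces \<open>U \<subseteq> T\<close>.\<close>
    have "U = T \<inter> D_mat" if U: "U \<in> ?D" "T \<inter> D_mat \<subseteq> U" for U
    proof -
      have "hull_Q U \<in> ?Q"
        using U(1) assms by (auto simp: Nil_upto_D_mat_iff intro: hull_Q_Nil_upto)
      moreover have "T \<subseteq> hull_Q U"
        using hull_Q_mono[OF U(2)] maximal_hull_Q_Int_D_mat[OF T assms] by simp
      ultimately have "hull_Q U = T"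
        using T by (auto simp: maximal_members_def)
      then show ?thesis
        using U hull_Q_superset[of U] by (auto simp: Nil_upto_D_mat_iff)
    qed
    then show ?thesis
      using T assms Nil_upto_Int_D_mat by (auto simp: maximal_members_def)
  qed
  then show "(\<lambda>T. T \<inter> D_mat) \<in> maximal_members ?Q \<rightarrow> maximal_members ?D" by blast
  show "hull_Q (T \<inter> D_mat) = T" if "T \<in> maximal_members ?Q" for T
    using that assms by (rule maximal_hull_Q_Int_D_mat)
  \<comment> \<open>\<open>M\<close> extends to a maximal \<open>T\<close> in \<open>Q_mat\<close>.
    The trace of \<open>T\<close> on \<open>D_mat\<close> is nilpotent and contains
    \<open>M\<close>, so it equals \<open>M\<close> by maximality.\<close>
  have surj: "\<exists>T\<in>maximal_members ?Q. T \<inter> D_mat = M" if M: "M \<in> maximal_members ?D" for M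
  proof -
    from M have "M \<in> ?Q" "M \<subseteq> D_mat"
      by (auto simp: maximal_members_def Nil_upto_D_mat_iff)
    then obtain T where T: "T \<in> maximal_members ?Q" "M \<subseteq> T"
      using Nil_upto_extends_to_maximal[of Q_mat "(**)" O_mat k M] assms by (auto simp: O_mat_zero)
    then have "T \<inter> D_mat \<in> ?D" "M \<subseteq> T \<inter> D_mat"
      using \<open>M \<subseteq> D_mat\<close> assms Nil_upto_Int_D_mat by (auto simp: maximal_members_def)
    then have "T \<inter> D_mat = M"
      using M by (auto simp: maximal_members_def)
    with T(1) show ?thesis by blast
  qed
  show "hull_Q \<in> maximal_members ?D \<rightarrow> maximal_members ?Q"
    using surj maximal_hull_Q_Int_D_mat[OF _ assms] by fastforce
  show "hull_Q M \<inter> D_mat = M" if "M \<in> maximal_members ?D" for M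
    using surj[OF that] maximal_hull_Q_Int_D_mat[OF _ assms] by fastforce
qed

section \<open>Strictly triangular operators\<close>

text \<open>The operators lowering the flag spanned by the initial segments of \<open>b\<close>. For
  \<open>i = 0\<close> the span is zero, so \<open>b 0\<close> is killed.\<close>

definition strictly_triangular :: "(nat \<Rightarrow> real^'n) \<Rightarrow> nat \<Rightarrow> (real^'n^'n) set" where
  "strictly_triangular b d = {X. \<forall>i<d. X *v b i \<in> span (b ` {..<i})}"

text \<open>Otherwise each vector of \<open>H\<close> outside \<open>G\<close> could be sent by some
  member of \<open>M\<close> to another such vector; after \<open>m\<close> rounds a product equal
  to 0 would map a vector outside \<open>G\<close>.\<close>

lemma nilpotent_imp_vector_mapped_into_subspace:
  fixes M :: "(real^'n^'n) set"
  assumes maps: "\<forall>X\<in>M. \<forall>v\<in>H. X *v v \<in> H" and nil: "set_power (**) M m = {0}" and "m \<ge> 1"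
    and G: "subspace G" "\<not> H \<subseteq> G"
  shows "\<exists>w\<in>H - G. \<forall>X\<in>M. X *v w \<in> G"
proof (rule ccontr)
  assume "\<not> ?thesis"
  then have ex: "\<exists>X\<in>M. X *v w \<in> H - G" if "w \<in> H - G" for w
    using that maps by blast
  have "\<exists>P\<in>set_power (**) M j. P *v w \<notin> G" if "j \<ge> 1" "w \<in> H - G" for j w
    using that
  proof (induction j arbitrary: w rule: nat_induct_from_1)
    case one
    then show ?case using ex by auto
  next
    case (Suc j)
    \<comment> \<open>\<open>X\<close> acts first and hence becomes the rightmost factor, which is
      the side on which \<open>set_power\<close> adds factors.\<close>
    then obtain X where X: "X \<in> M" "X *v w \<in> H - G" using ex by blast
    with Suc obtain P where "P \<in> set_power (**) M j" "P *v (X *v w) \<notin> G" by blast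
    with X Suc.hyps show ?case
      by (auto simp: set_power_Suc matrix_vector_mul_assoc)
  qed
  moreover obtain w where "w \<in> H - G" using G(2) by blast
  ultimately have "\<exists>P\<in>set_power (**) M m. P *v w \<notin> G" using \<open>m \<ge> 1\<close> by blast
  then have "(0 :: real^'n^'n) *v w \<notin> G" unfolding nil by simp
  then show False using subspace_0[OF G(1)] by simp
qed

text \<open>The basis grows one vector at a time: with \<open>G\<close> the span of the vectors
  found so far, the preceding lemma gives a new vector, outside \<open>G\<close>, that all of
  \<open>M\<close> maps into \<open>G\<close>.\<close>

lemma nilpotent_imp_strictly_triangular:
  fixes M :: "(real^'n^'n) set"
  assumes maps: "\<forall>X\<in>M. \<forall>v\<in>H. X *v v \<in> H"
    and nil: "set_power (**) M m = {0}" "m \<ge> 1" and "d \<le> dim H"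
  shows "\<exists>b. inj_on b {..<d} \<and> independent (b ` {..<d}) \<and> b ` {..<d} \<subseteq> H \<and>
    M \<subseteq> strictly_triangular b d"
  using \<open>d \<le> dim H\<close>
proof (induction d)
  case 0
  show ?case by (auto simp: strictly_triangular_def independent_empty)
next
  case (Suc d)
  then obtain b where b: "inj_on b {..<d}" "independent (b ` {..<d})" "b ` {..<d} \<subseteq> H"
    "M \<subseteq> strictly_triangular b d" by auto
  let ?G = "span (b ` {..<d})"
  have "dim ?G = d"
    using b(1,2) by (simp add: dim_eq_card_independent card_image)
  with Suc.prems have "\<not> H \<subseteq> ?G" using dim_subset[of H ?G] by auto
  then obtain w where w: "w \<in> H" "w \<notin> ?G" "\<forall>X\<in>M. X *v w \<in> ?G"
    using nilpotent_imp_vector_mapped_into_subspace[OF maps nil subspace_span, of "b ` {..<d}"] by blast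
  define c where "c = b(d := w)"
  have im: "c ` {..<i} = b ` {..<i}" if "i \<le> d" for i
    using that by (auto simp: c_def image_def)
  have imS: "c ` {..<Suc d} = insert w (b ` {..<d})"
    unfolding lessThan_Suc image_insert im[OF order_refl] by (simp add: c_def)
  have "w \<notin> b ` {..<d}" using w(2) by (metis span_base)
  then have "inj_on c {..<Suc d}"
    using b(1) by (auto simp: inj_on_def c_def less_Suc_eq image_iff)
  moreover have "independent (c ` {..<Suc d})"
    unfolding imS using b(2) w(2) by (intro independent_insertI)
  moreover have "c ` {..<Suc d} \<subseteq> H" unfolding imS using w(1) b(3) by simp
  moreover have "M \<subseteq> strictly_triangular c (Suc d)"
  proof -
    have "X *v c i \<in> span (c ` {..<i})" if "X \<in> M" "i < Suc d" for X i
      using that w(3) b(4) by (cases "i = d") (auto simp: im strictly_triangular_def c_def)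
    then show ?thesis by (auto simp: strictly_triangular_def)
  qed
  ultimately show ?case by blast
qed

text \<open>One application lowers the flag by one step. Truncated subtraction is harmless at
  \<open>i = 0\<close>, where both spans are zero.\<close>

lemma strictly_triangular_span:
  assumes "X \<in> strictly_triangular b d" "v \<in> span (b ` {..<i})" "i \<le> d"
  shows "X *v v \<in> span (b ` {..<i - 1})"
  using assms(2)
proof (induction rule: span_induct)
  case base
  show ?case
    by (auto simp: subspace_def algebra_simps span_zero span_add span_scale
        scaleR_matrix_vector_assoc[symmetric] matrix_vector_mult_scaleR)
next
  case (step x)
  then obtain j where j: "x = b j" "j < i" by blast
  then have "X *v x \<in> span (b ` {..<j})"
    using assms by (auto simp: strictly_triangular_def)
  moreover have "span (b ` {..<j}) \<subseteq> span (b ` {..<i - 1})"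
    using j(2) by (intro span_mono image_mono) auto
  ultimately show ?case by blast
qed

lemma strictly_triangular_mult:
  assumes "X \<in> strictly_triangular b d" "Y \<in> strictly_triangular b d"
  shows "X ** Y \<in> strictly_triangular b d"
proof -
  have "(X ** Y) *v b i \<in> span (b ` {..<i})" if "i < d" for i
  proof -
    have "Y *v b i \<in> span (b ` {..<i})" using assms(2) that by (simp add: strictly_triangular_def)
    then have "X *v (Y *v b i) \<in> span (b ` {..<i - 1})"
      using strictly_triangular_span[OF assms(1)] that by simp
    moreover have "span (b ` {..<i - 1}) \<subseteq> span (b ` {..<i})"
      by (intro span_mono image_mono) auto
    ultimately show ?thesis by (auto simp: matrix_vector_mul_assoc)
  qed
  then show ?thesis by (simp add: strictly_triangular_def)
qed

text \<open>Each of the \<open>j\<close> factors lowers the flag by one step. For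
  \<open>i = j = d\<close> this says that \<open>d\<close> factors annihilate the whole
  span.\<close>

lemma strictly_triangular_power_span:
  assumes "j \<ge> 1" "P \<in> set_power (**) (strictly_triangular b d) j"
    "v \<in> span (b ` {..<i})" "i \<le> d"
  shows "P *v v \<in> span (b ` {..<i - j})"
  using assms
proof (induction j arbitrary: P v i rule: nat_induct_from_1)
  case one
  then show ?case using strictly_triangular_span by simp
next
  case (Suc j)
  then obtain A B where P: "P = A ** B" "A \<in> set_power (**) (strictly_triangular b d) j"
    "B \<in> strictly_triangular b d"
    by (auto simp: set_power_Suc)
  have "A *v (B *v v) \<in> span (b ` {..<i - 1 - j})"
    using strictly_triangular_span[OF P(3) Suc.prems(2,3)] Suc.prems(3) by (intro Suc.IH P(2)) auto
  then show ?case by (simp add: P(1) matrix_vector_mul_assoc)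
qed

section \<open>The shift operator and its powers\<close>

lemma zero_sum_basis_shift:
  fixes b :: "nat \<Rightarrow> real^'n"
  assumes "inj_on b {..<d}" "independent (b ` {..<d})" "span (b ` {..<d}) = zero_sum_vec"
  shows "\<exists>N \<in> zero_sum_mat \<inter> strictly_triangular b d. \<forall>i. Suc i < d \<longrightarrow> N *v b (Suc i) = b i"
proof -
  \<comment> \<open>\<open>f\<close> sends each basis vector to its predecessor and
    \<open>b 0\<close> to 0; the inverse of \<open>b\<close> recovers the index.\<close>
  define f where "f x = (let i = inv_into {..<d} b x in if i = 0 then 0 else b (i - 1))" for x
  have f: "f (b i) = (if i = 0 then 0 else b (i - 1))" if "i < d" for i
    using inv_into_f_f[OF assms(1), of i] that by (simp add: f_def)
  obtain g where g: "linear g" "\<forall>x\<in>b ` {..<d}. g x = f x"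
    using linear_independent_extend[OF assms(2), of f] by blast
  \<comment> \<open>Projecting onto the hyperplane first makes \<open>N\<close> kill the constant
    vectors and leaves its values on the basis unchanged.\<close>
  define N where "N = matrix (\<lambda>v. g (v - O_mat *v v))"
  have "linear (\<lambda>v :: real^'n. v - O_mat *v v)"
    by (intro linear_compose_sub matrix_vector_mul_linear linear_id[unfolded id_def])
  from linear_compose[OF this g(1)] have N: "N *v v = g (v - O_mat *v v)" for v
    by (simp add: N_def o_def matrix_works)
  have b: "b i \<in> zero_sum_vec" if "i < d" for i
    using that assms(3) span_base[of "b i" "b ` {..<d}"] by auto
  have Nb: "N *v b i = f (b i)" if "i < d" for i
    using b[OF that] g(2) that by (simp add: N O_mat_mult_vec zero_sum_vec_def)
  have "g ` (b ` {..<d}) \<subseteq> zero_sum_vec"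
    using g(2) f b subspace_0[OF subspace_zero_sum_vec] by auto
  then have "span (g ` (b ` {..<d})) \<subseteq> zero_sum_vec"
    using span_minimal subspace_zero_sum_vec by blast
  then have "g ` zero_sum_vec \<subseteq> zero_sum_vec"
    using linear_span_image[OF g(1), of "b ` {..<d}"] assms(3) by simp
  then have "N *v v \<in> zero_sum_vec" for v
    using diff_O_mat_mult_vec[of v] by (auto simp: N)
  moreover have "N *v 1 = 0"
    using linear_0[OF g(1)] by (simp add: N O_mat_mult_vec)
  moreover have "N *v b i \<in> span (b ` {..<i})" if "i < d" for i
    using that by (auto simp: Nb f span_zero intro!: span_base)
  ultimately have "N \<in> zero_sum_mat \<inter> strictly_triangular b d"
    by (simp add: zero_sum_mat_def strictly_triangular_def)
  moreover have "N *v b (Suc i) = b i" if "Suc i < d" for i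
    using Nb[OF that] f[OF that] by simp
  ultimately show ?thesis by blast
qed

text \<open>The witness is the \<open>j\<close>-th power of \<open>N\<close>. The scalar
  \<open>c\<close> is there because only a small multiple of the shift is sure to come from
  \<open>D_mat\<close>.\<close>

lemma shift_power:
  fixes N :: "real^'n^'n"
  assumes shift: "\<forall>i. Suc i < d \<longrightarrow> N *v b (Suc i) = c *\<^sub>R b i" and "j \<ge> 1" "N \<in> T"
  shows "\<exists>P\<in>set_power (**) T j. \<forall>i. i + j < d \<longrightarrow> P *v b (i + j) = (c ^ j) *\<^sub>R b i"
  using \<open>j \<ge> 1\<close>
proof (induction j rule: nat_induct_from_1)
  case one
  show ?case using shift \<open>N \<in> T\<close> by auto
next
  case (Suc j)
  then obtain P where P: "P \<in> set_power (**) T j"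
    "\<And>i. i + j < d \<Longrightarrow> P *v b (i + j) = (c ^ j) *\<^sub>R b i" by blast
  have "(P ** N) *v b (i + Suc j) = (c ^ Suc j) *\<^sub>R b i" if "i + Suc j < d" for i
    using that shift P(2)[of i]
    by (simp add: matrix_vector_mul_assoc[symmetric] matrix_vector_mult_scaleR)
  moreover have "P ** N \<in> set_power (**) T (Suc j)"
    using P(1) \<open>N \<in> T\<close> Suc.hyps by (auto simp: set_power_Suc)
  ultimately show ?case by blast
qed

section \<open>Nilpotency classes of doubly stochastic matrices\<close>

text \<open>\<open>T\<close> is triangular in some basis of the hyperplane. All doubly stochastic
  matrices triangular in that basis form \<open>U\<close>: flag length bounds its class above, the
  shift bounds it below.\<close>

lemma Nil_all_extends_to_class_card_minus_1:
  fixes T :: "(real^'n^'n) set"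
  assumes n: "CARD('n) \<ge> 2" and T: "T \<in> Nil_all (**) O_mat D_mat"
  obtains U where "U \<in> Nil_upto (**) O_mat D_mat (CARD('n) - 1)" "T \<subseteq> U"
    "nilpotency_class (**) O_mat U = CARD('n) - 1"
proof -
  \<comment> \<open>The dimension of the hyperplane, hence the length of a full flag.\<close>
  define d where "d = CARD('n) - 1"
  have "d \<ge> 1" using n by (simp add: d_def)
  note iff = Nil_upto_mat_iff[OF D_mat_subset_Q_mat]
  from T obtain m where m: "m \<ge> 1" "T \<in> Nil_upto (**) O_mat D_mat m"
    by (auto simp: Nil_all_def)
  then have sub: "T \<subseteq> D_mat" and nil: "set_power (**) (centre T) m = {0}"
    by (auto simp: iff subsemigroup_def)
  have cT: "centre T \<subseteq> zero_sum_mat"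
    using sub D_mat_subset_Q_mat by (auto simp: Q_mat_iff_zero_sum)
  then have maps: "\<forall>X\<in>centre T. \<forall>v\<in>zero_sum_vec. X *v v \<in> zero_sum_vec"
    unfolding zero_sum_mat_def by blast
  obtain b where b: "inj_on b {..<d}" "independent (b ` {..<d})" "b ` {..<d} \<subseteq> zero_sum_vec"
    "centre T \<subseteq> strictly_triangular b d"
    using nilpotent_imp_strictly_triangular[OF maps nil \<open>m \<ge> 1\<close>, of d]
    unfolding dim_zero_sum_vec d_def by blast
  have "card (b ` {..<d}) = dim (zero_sum_vec :: (real^'n) set)"
    using b(1) by (simp add: card_image dim_zero_sum_vec d_def)
  then have span_b: "span (b ` {..<d}) = zero_sum_vec"
    using b(2,3) subspace_zero_sum_vec
    by (metis card_ge_dim_independent order_refl span_minimal subset_antisym)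
  define U where "U = {A \<in> D_mat. A - O_mat \<in> strictly_triangular b d}"
  have cU: "centre U \<subseteq> zero_sum_mat \<inter> strictly_triangular b d"
    using D_mat_subset_Q_mat by (auto simp: U_def Q_mat_iff_zero_sum)
  have "T \<subseteq> U" using sub b(4) by (auto simp: U_def)
  have OU: "O_mat \<in> U"
    using O_mat_in_D_mat by (auto simp: U_def strictly_triangular_def span_zero)
  have "A ** B \<in> U" if "A \<in> U" "B \<in> U" for A B
    using that
    by (simp add: U_def D_mat_subset_Q_mat[THEN subsetD] D_mat_mult_closed Q_mat_mult_diff_O_mat strictly_triangular_mult)
  with OU have subU: "subsemigroup (**) D_mat U"
    by (auto simp: subsemigroup_def U_def)
  have "P = 0" if P: "P \<in> set_power (**) (centre U) d" for P
  proof (rule zero_sum_mat_eqI)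
    have sets: "centre U \<subseteq> zero_sum_mat" "centre U \<subseteq> strictly_triangular b d"
      using cU by simp_all
    have "set_power (**) (zero_sum_mat :: (real^'n^'n) set) d \<subseteq> zero_sum_mat"
      by (rule set_power_subset) (simp add: zero_sum_mat_mult)
    with P show "P \<in> zero_sum_mat"
      using set_power_mono[OF sets(1), of "(**)" d] by blast
    have "P \<in> set_power (**) (strictly_triangular b d) d"
      using P set_power_mono[OF sets(2), of "(**)" d] by blast
    then show "P *v v = 0" if "v \<in> zero_sum_vec" for v
      using strictly_triangular_power_span[OF \<open>d \<ge> 1\<close>, of P b d v d] that
      by (simp add: span_b)
  qed
  then have "set_power (**) (centre U) d = {0}"
    using OU \<open>d \<ge> 1\<close> by (intro set_power_eq_singletonI) auto
  then have UN: "U \<in> Nil_upto (**) O_mat D_mat d"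
    using subU \<open>d \<ge> 1\<close> by (simp add: iff)
  obtain N where N: "N \<in> zero_sum_mat" "N \<in> strictly_triangular b d"
    "\<forall>i. Suc i < d \<longrightarrow> N *v b (Suc i) = b i"
    using zero_sum_basis_shift[OF b(1,2) span_b] by blast
  obtain e where e: "e > 0" "O_mat + e *\<^sub>R N \<in> D_mat"
    using D_mat_neighbourhood[OF N(1)] by blast
  have eN: "e *\<^sub>R N \<in> centre U"
    using e N(2)
    by (intro image_eqI[of _ _ "O_mat + e *\<^sub>R N"])
      (auto simp: U_def strictly_triangular_def scaleR_matrix_vector_assoc[symmetric] span_scale)
  define c where "c = nilpotency_class (**) O_mat U"
  have "nilpotent_set (**) O_mat U" "c \<le> d" using UN by (auto simp: Nil_upto_def c_def)
  then have c: "c \<ge> 1" "set_power (**) U c = {O_mat}"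
    using nilpotency_class_power[of "(**)" O_mat U] by (simp_all only: c_def)
  then have c0: "set_power (**) (centre U) c = {0}"
    using set_power_O_mat_iff[of U] D_mat_subset_Q_mat by (auto simp: U_def)
  \<comment> \<open>If \<open>c < d\<close>, the \<open>c\<close>-th power of the scaled shift would
    send \<open>b c\<close> to \<open>e ^ c\<close> times \<open>b 0\<close>, a nonzero vector,
    although all products of \<open>c\<close> elements of \<open>centre U\<close> vanish.\<close>
  have "\<not> c < d"
  proof
    assume "c < d"
    have "\<forall>i. Suc i < d \<longrightarrow> (e *\<^sub>R N) *v b (Suc i) = e *\<^sub>R b i"
      using N(3) by (simp add: scaleR_matrix_vector_assoc[symmetric])
    from shift_power[OF this c(1) eN] c0 have "(0 :: real^'n^'n) *v b (0 + c) = (e ^ c) *\<^sub>R b 0"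
      using \<open>c < d\<close> by (metis add_0 singletonD)
    then have "b 0 = 0" using e(1) by simp
    moreover have "b 0 \<in> b ` {..<d}" using \<open>c < d\<close> by auto
    ultimately show False using b(2) dependent_zero by metis
  qed
  with \<open>c \<le> d\<close> have "nilpotency_class (**) O_mat U = d" by (simp add: c_def)
  with that UN \<open>T \<subseteq> U\<close> show ?thesis by (simp add: d_def)
qed

theorem theorem4p7:
  fixes k :: nat
  assumes "CARD('n::finite) \<ge> 2" and "k \<ge> 1"
  shows "bij_betw (\<lambda>T. T \<inter> D_mat)
           (max_nilpotent_of_class (**) O_mat (Q_mat :: (real^'n^'n) set) k)
           (max_nilpotent_of_class (**) O_mat (D_mat :: (real^'n^'n) set) k)
       \<and> (\<forall>T \<in> Nil_all (**) O_mat (D_mat :: (real^'n^'n) set).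
             \<exists>M \<in> max_nilpotent (**) O_mat D_mat. T \<subseteq> M)
       \<and> (\<forall>M \<in> max_nilpotent (**) O_mat (D_mat :: (real^'n^'n) set).
             nilpotency_class (**) O_mat M = CARD('n) - 1)"
proof (intro conjI ballI)
  let ?D = "D_mat :: (real^'n^'n) set"
  let ?d = "CARD('n) - 1"
  have d: "?d \<ge> 1" using assms(1) by simp
  \<comment> \<open>A uniform bound on the class puts all nilpotent subsemigroups within reach of
    the Zorn argument for bounded class.\<close>
  have Nil_all: "Nil_all (**) O_mat ?D = Nil_upto (**) O_mat ?D ?d"
  proof
    show "Nil_upto (**) O_mat ?D ?d \<subseteq> Nil_all (**) O_mat ?D"
      using d by (auto simp: Nil_all_def)
    show "Nil_all (**) O_mat ?D \<subseteq> Nil_upto (**) O_mat ?D ?d"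
    proof
      fix T assume T: "T \<in> Nil_all (**) O_mat ?D"
      then obtain U where U: "U \<in> Nil_upto (**) O_mat ?D ?d" "T \<subseteq> U"
        using Nil_all_extends_to_class_card_minus_1[OF assms(1)] by blast
      note iff = Nil_upto_mat_iff[OF D_mat_subset_Q_mat d]
      from T have sub: "subsemigroup (**) ?D T"
        by (auto simp: Nil_all_def Nil_upto_def)
      have "set_power (**) (centre T) ?d \<subseteq> {0}"
        using U set_power_mono[OF image_mono[OF U(2)], of "(**)" "\<lambda>A. A - O_mat" ?d]
        unfolding iff by blast
      with sub have "set_power (**) (centre T) ?d = {0}"
        using d by (intro set_power_eq_singletonI) (auto simp: subsemigroup_def)
      with sub show "T \<in> Nil_upto (**) O_mat ?D ?d" unfolding iff by blast
    qed
  qed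
  show "bij_betw (\<lambda>T. T \<inter> D_mat)
      (max_nilpotent_of_class (**) O_mat (Q_mat :: (real^'n^'n) set) k)
      (max_nilpotent_of_class (**) O_mat ?D k)"
    using assms(2) by (rule bij_betw_Int_D_mat)
  show "\<exists>M \<in> max_nilpotent (**) O_mat D_mat. T \<subseteq> M" if "T \<in> Nil_all (**) O_mat ?D" for T
    unfolding max_nilpotent_def Nil_all
    using that d D_mat_subset_Q_mat unfolding Nil_all
    by (intro Nil_upto_extends_to_maximal) (auto simp: O_mat_zero)
  show "nilpotency_class (**) O_mat M = ?d" if "M \<in> max_nilpotent (**) O_mat ?D" for M
  proof -
    from that have M: "M \<in> Nil_all (**) O_mat ?D" "\<forall>U\<in>Nil_all (**) O_mat ?D. M \<subseteq> U \<longrightarrow> U = M"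
      by (auto simp: max_nilpotent_def maximal_members_def)
    \<comment> \<open>\<open>M\<close> lies in a nilpotent subsemigroup of class exactly
      \<open>n - 1\<close>, and maximality makes the two equal.\<close>
    then show ?thesis
      using Nil_all_extends_to_class_card_minus_1[OF assms(1) M(1)] Nil_all by metis
  qed
qed

end
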